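(* Let $M$ be a matroid with an adjoint map $\phi$ to $M'$, and let $C\subseteq E(M)$. Then there is an adjoint map $\phi_{/C}$ from $M/C$ to $M'|\phi(\mathrm{cl}_M(C))$ given by $\phi_{/C}(F)=\phi(F\cup C)$ for each flat $F\in\mathcal{F}(M/C)$.
   Context: Matroid terminology follows Oxley's book; in particular matroids are finite. $E(M)$ is the ground set of $M$, $\mathrm{cl}_M$ is its closure operator, $\mathcal{F}(M)$ is the collection of flats of $M$, $M/C$ is contraction, and $M'|X$ is the restriction of $M'$ to $X$. A set $F\subseteq E(M)-C$ is a flat of $M/C$ if and only if $F\cup C$ is a flat of $M$. A hyperplane of $M$ is a flat of rank $r(M)-1$; a point is a flat of rank $1$ (in a simple matroid, the points are exactly the singletons of elements of the ground set, and are identified with the elements). Definition. Let $M$ be a matroid, and let $M'$ be a simple matroid with the same rank as $M$. Then $M'$ is an adjoint of $M$ if there is a map $\phi:\mathcal{F}(M)\rightarrow\mathcal{F}(M')$ such that (i) $\phi$ is injective; (ii) if $F_1,F_2\in\mathcal{F}(M)$ and $F_1\subseteq F_2$, then $\phi(F_2)\subseteq\phi(F_1)$; and (iii) $\phi$ restricts to a bijection from the set of hyperplanes of $M$ onto the set of points of $M'$. Such a map $\phi$ is called an adjoint map from $M$ to $M'$. (Thus saying that there is an adjoint map from one matroid to another includes that the second matroid is simple and has the same rank as the first.) *)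

theory Defs
  imports Main
begin

record 'a indep_system =
  ground :: "'a set"
  indeps :: "'a set set"

locale matroid =
  fixes M :: "'a indep_system"
  assumes finite_ground: "finite (ground M)"
    and indeps_subset: "I \<in> indeps M \<Longrightarrow> I \<subseteq> ground M"
    and empty_indep: "{} \<in> indeps M"
    and indep_mono: "\<lbrakk>I \<in> indeps M; J \<subseteq> I\<rbrakk> \<Longrightarrow> J \<in> indeps M"
    and augment: "\<lbrakk>I \<in> indeps M; J \<in> indeps M; card I < card J\<rbrakk>
      \<Longrightarrow> \<exists>e \<in> J - I. insert e I \<in> indeps M"

definition bases :: "'a indep_system \<Rightarrow> 'a set set" where
  "bases M = {B \<in> indeps M. \<forall>I \<in> indeps M. B \<subseteq> I \<longrightarrow> I = B}"

definition circuits :: "'a indep_system \<Rightarrow> 'a set set" where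
  "circuits M = {K. K \<subseteq> ground M \<and> K \<notin> indeps M \<and> (\<forall>J. J \<subset> K \<longrightarrow> J \<in> indeps M)}"

definition rk :: "'a indep_system \<Rightarrow> 'a set \<Rightarrow> nat" where
  "rk M X = Max (card ` {I \<in> indeps M. I \<subseteq> X})"

definition cl :: "'a indep_system \<Rightarrow> 'a set \<Rightarrow> 'a set" where
  "cl M X = {e \<in> ground M. rk M (insert e X) = rk M X}"

definition flats :: "'a indep_system \<Rightarrow> 'a set set" where
  "flats M = {F. F \<subseteq> ground M \<and> cl M F = F}"

(* Stated additively: truncated subtraction would make the unique flat of a
   rank-0 matroid a hyperplane. *)
definition hyperplanes :: "'a indep_system \<Rightarrow> 'a set set" where
  "hyperplanes M = {H \<in> flats M. rk M H + 1 = rk M (ground M)}"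

definition points :: "'a indep_system \<Rightarrow> 'a set set" where
  "points M = {P \<in> flats M. rk M P = 1}"

definition restriction :: "'a indep_system \<Rightarrow> 'a set \<Rightarrow> 'a indep_system" where
  "restriction M X = \<lparr>ground = X, indeps = {I \<in> indeps M. I \<subseteq> X}\<rparr>"

definition deletion :: "'a indep_system \<Rightarrow> 'a set \<Rightarrow> 'a indep_system" where
  "deletion M X = restriction M (ground M - X)"

definition dual :: "'a indep_system \<Rightarrow> 'a indep_system" where
  "dual M = \<lparr>ground = ground M, indeps = {I. \<exists>B \<in> bases M. I \<subseteq> ground M - B}\<rparr>"

definition contraction :: "'a indep_system \<Rightarrow> 'a set \<Rightarrow> 'a indep_system" where
  "contraction M C = dual (deletion (dual M) C)"

locale simple_matroid = matroid +
  assumes no_loop: "{e} \<notin> circuits M"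
    and no_parallel: "e \<noteq> f \<Longrightarrow> {e, f} \<notin> circuits M"

(* Only the values of phi on the flats of M are constrained. *)
locale adjoint_map = M: matroid M + M': simple_matroid M'
  for M :: "'a indep_system" and M' :: "'b indep_system" +
  fixes \<phi> :: "'a set \<Rightarrow> 'b set"
  assumes same_rank: "rk M' (ground M') = rk M (ground M)"
    and maps_flats: "F \<in> flats M \<Longrightarrow> \<phi> F \<in> flats M'"
    and inj_flats: "inj_on \<phi> (flats M)"
    and antimono_flats: "\<lbrakk>F\<^sub>1 \<in> flats M; F\<^sub>2 \<in> flats M; F\<^sub>1 \<subseteq> F\<^sub>2\<rbrakk> \<Longrightarrow> \<phi> F\<^sub>2 \<subseteq> \<phi> F\<^sub>1"
    and bij_hyperplanes_points: "bij_betw \<phi> (hyperplanes M) (points M')"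

end

theory Submission
  imports Defs
begin

text \<open>
  Following chains of flats shows that an adjoint map satisfies \<open>rk (\<phi> F) = r(M) - rk F\<close>, which
  gives the rank of the restriction to \<open>\<phi> (cl C)\<close>. The remaining point is that every point of
  \<open>M'\<close> inside \<open>\<phi> (cl C)\<close> comes from a hyperplane containing \<open>C\<close>, that is, that
  \<open>\<phi> H \<subseteq> \<phi> F\<close> implies \<open>F \<subseteq> H\<close> for a hyperplane \<open>H\<close> and a flat \<open>F\<close>. In a counterexample with
  \<open>F\<close> of maximal rank, every flat \<open>L \<subseteq> H\<close> satisfies \<open>\<phi> F \<subseteq> \<phi> L\<close>. If \<open>L\<close> is a point outside
  \<open>F\<close>, this holds because \<open>\<phi> F\<close> is spanned by \<open>\<phi> H\<close> and \<open>\<phi> (cl (F \<union> L))\<close>. If \<open>L\<close> has rank at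
  least 2, it covers two distinct flats \<open>A\<close> and \<open>B\<close> with \<open>\<phi> F \<subseteq> \<phi> A \<inter> \<phi> B\<close>, and otherwise
  \<open>\<phi> L\<close> and \<open>\<phi> F\<close> would span both \<open>\<phi> A\<close> and \<open>\<phi> B\<close>. For \<open>L = H\<close> this gives \<open>\<phi> F = \<phi> H\<close>.
\<close>

context matroid
begin

subsection \<open>Rank and closure\<close>

lemma indep_finite: "I \<in> indeps M \<Longrightarrow> finite I"
  using indeps_subset finite_ground finite_subset by blast

lemma finite_indeps_within: "finite {I \<in> indeps M. I \<subseteq> X}"
  by (rule finite_subset[of _ "Pow (ground M)"]) (use indeps_subset finite_ground in auto)

lemma card_le_rk: "\<lbrakk>I \<in> indeps M; I \<subseteq> X\<rbrakk> \<Longrightarrow> card I \<le> rk M X"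
  unfolding rk_def using finite_indeps_within[of X] by (intro Max_ge) auto

lemma rk_attained: "\<exists>I \<in> indeps M. I \<subseteq> X \<and> card I = rk M X"
proof -
  have "rk M X \<in> card ` {I \<in> indeps M. I \<subseteq> X}"
    unfolding rk_def using finite_indeps_within[of X] empty_indep by (intro Max_in) auto
  then show ?thesis by auto
qed

lemma rk_leI: "(\<And>I. \<lbrakk>I \<in> indeps M; I \<subseteq> X\<rbrakk> \<Longrightarrow> card I \<le> n) \<Longrightarrow> rk M X \<le> n"
  using rk_attained[of X] by metis

text \<open>A largest independent subset of \<open>X\<close> supplies elements for augmenting
  \<open>I\<close> inside \<open>X\<close>; each one shrinks the deficit
  \<open>rk M X - card I\<close>, on which the induction runs.\<close>

lemma indep_extend:
  assumes "I \<in> indeps M" "I \<subseteq> X"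
  obtains B where "B \<in> indeps M" "I \<subseteq> B" "B \<subseteq> X" "card B = rk M X"
proof -
  have "\<exists>B \<in> indeps M. I \<subseteq> B \<and> B \<subseteq> X \<and> card B = rk M X"
    using assms
  proof (induction "rk M X - card I" arbitrary: I rule: less_induct)
    case less
    show ?case
    proof (cases "card I = rk M X")
      case True
      then show ?thesis using less.prems by blast
    next
      case False
      then have lt: "card I < rk M X" using card_le_rk[OF less.prems] by simp
      obtain J where J: "J \<in> indeps M" "J \<subseteq> X" "card J = rk M X" using rk_attained by blast
      then obtain e where e: "e \<in> J - I" "insert e I \<in> indeps M"
        using augment[OF less.prems(1) J(1)] lt by auto
      have "card (insert e I) = Suc (card I)"
        using e(1) indep_finite[OF less.prems(1)] by simp
      then have "rk M X - card (insert e I) < rk M X - card I" using lt by simp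
      moreover have "insert e I \<subseteq> X" using e(1) J(2) less.prems(2) by blast
      ultimately show ?thesis using less.hyps[OF _ e(2)] by blast
    qed
  qed
  then show thesis using that by blast
qed

lemma rk_mono: "X \<subseteq> Y \<Longrightarrow> rk M X \<le> rk M Y"
  by (rule rk_leI) (meson card_le_rk order_trans)

lemma rk_indep: "I \<in> indeps M \<Longrightarrow> rk M I = card I"
  by (intro antisym rk_leI card_le_rk) (auto intro: card_mono indep_finite)

lemma rk_union_le:
  assumes "finite Y"
  shows "rk M (X \<union> Y) \<le> rk M X + card Y"
proof (rule rk_leI)
  fix I assume I: "I \<in> indeps M" "I \<subseteq> X \<union> Y"
  have "card I = card (I \<inter> X) + card (I - X)"
    using card_Int_Diff[OF indep_finite[OF I(1)]] .
  moreover have "card (I \<inter> X) \<le> rk M X"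
    using I(1) by (intro card_le_rk indep_mono[OF I(1)]) auto
  moreover have "card (I - X) \<le> card Y" using I(2) assms by (intro card_mono) auto
  ultimately show "card I \<le> rk M X + card Y" by simp
qed

lemma rk_insert_le: "rk M (insert e X) \<le> Suc (rk M X)"
  using rk_union_le[of "{e}" X] by simp

text \<open>A local form of submodularity, the source of monotonicity and idempotence of closure. If
  \<open>e\<close> raised the rank of \<open>Y\<close>, then a basis of \<open>X\<close>, extended
  to a basis of \<open>insert e Y\<close>, would have to gain \<open>e\<close>; hence that basis of
  \<open>X\<close> together with \<open>e\<close> would be independent and too large.\<close>

lemma rk_insert_eq_mono:
  assumes "X \<subseteq> Y" "rk M (insert e X) = rk M X"
  shows "rk M (insert e Y) = rk M Y"
proof (rule ccontr)
  assume "rk M (insert e Y) \<noteq> rk M Y"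
  then have gt: "rk M Y < rk M (insert e Y)" using rk_mono[OF subset_insertI, of Y e] by linarith
  then have "e \<notin> Y" by (auto simp: insert_absorb)
  obtain A where A: "A \<in> indeps M" "A \<subseteq> X" "card A = rk M X" using rk_attained by blast
  then obtain B where B: "B \<in> indeps M" "A \<subseteq> B" "B \<subseteq> insert e Y" "card B = rk M (insert e Y)"
    using indep_extend[of A "insert e Y"] assms(1) by blast
  have "e \<in> B" using card_le_rk[OF B(1), of Y] B(3,4) gt by auto
  then have "insert e A \<in> indeps M" using indep_mono[OF B(1)] B(2) by simp
  moreover have "e \<notin> A" using A(2) assms(1) \<open>e \<notin> Y\<close> by blast
  ultimately show False
    using card_le_rk[of "insert e A" "insert e X"] A assms(2) indep_finite[OF A(1)] by auto
qed

lemma rk_union_eq: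
  assumes "finite Y" "\<And>e. e \<in> Y \<Longrightarrow> rk M (insert e X) = rk M X"
  shows "rk M (X \<union> Y) = rk M X"
  using assms
proof (induction Y rule: finite_induct)
  case (insert e Y)
  then show ?case using rk_insert_eq_mono[of X "X \<union> Y" e] by simp
qed simp

section \<open>Closure, flats and covering pairs of flats\<close>

lemma cl_subset_ground: "cl M X \<subseteq> ground M"
  by (auto simp: cl_def)

lemma subset_cl: "X \<subseteq> ground M \<Longrightarrow> X \<subseteq> cl M X"
  by (auto simp: cl_def insert_absorb)

lemma cl_mono: "X \<subseteq> Y \<Longrightarrow> cl M X \<subseteq> cl M Y"
  unfolding cl_def using rk_insert_eq_mono by auto

lemma rk_cl:
  assumes "X \<subseteq> ground M"
  shows "rk M (cl M X) = rk M X"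
proof -
  have "rk M (X \<union> cl M X) = rk M X"
    by (rule rk_union_eq) (auto simp: cl_def finite_ground)
  then show ?thesis using subset_cl[OF assms] by (simp add: Un_absorb1)
qed

lemma cl_flat:
  assumes "X \<subseteq> ground M"
  shows "cl M X \<in> flats M"
proof -
  have "cl M (cl M X) \<subseteq> cl M X"
  proof
    fix e assume e: "e \<in> cl M (cl M X)"
    then have "rk M (insert e (cl M X)) = rk M X" using rk_cl[OF assms] by (simp add: cl_def)
    moreover have "rk M (insert e X) \<le> rk M (insert e (cl M X))"
      using subset_cl[OF assms] by (intro rk_mono) auto
    moreover have "rk M X \<le> rk M (insert e X)" by (intro rk_mono) auto
    ultimately show "e \<in> cl M X" using e by (simp add: cl_def)
  qed
  then show ?thesis
    using subset_cl[OF cl_subset_ground] cl_subset_ground by (auto simp: flats_def)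
qed

lemma flat_subset_ground: "F \<in> flats M \<Longrightarrow> F \<subseteq> ground M"
  by (simp add: flats_def)

lemma cl_subset_flat: "\<lbrakk>F \<in> flats M; X \<subseteq> F\<rbrakk> \<Longrightarrow> cl M X \<subseteq> F"
  using cl_mono[of X F] by (simp add: flats_def)

lemma flat_eq_if_rk_le:
  assumes "F \<in> flats M" "G \<subseteq> ground M" "F \<subseteq> G" "rk M G \<le> rk M F"
  shows "F = G"
proof -
  have "e \<in> F" if "e \<in> G" for e
  proof -
    have "rk M (insert e F) \<le> rk M G" using assms(3) that by (intro rk_mono) auto
    moreover have "rk M F \<le> rk M (insert e F)" by (intro rk_mono) auto
    ultimately have "e \<in> cl M F" using assms that by (auto simp: cl_def)
    then show ?thesis using assms(1) by (simp add: flats_def)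
  qed
  then show ?thesis using assms(3) by blast
qed

lemma flat_rk_strict: "\<lbrakk>F \<in> flats M; G \<subseteq> ground M; F \<subset> G\<rbrakk> \<Longrightarrow> rk M F < rk M G"
  using flat_eq_if_rk_le[of F G] by (metis linorder_not_le psubset_eq)

lemma rk_insert_flat:
  assumes "F \<in> flats M" "e \<in> ground M - F"
  shows "rk M (insert e F) = Suc (rk M F)"
proof -
  have "insert e F \<subseteq> ground M" "F \<subset> insert e F"
    using assms(2) flat_subset_ground[OF assms(1)] by auto
  then have "rk M F < rk M (insert e F)" by (rule flat_rk_strict[OF assms(1)])
  then show ?thesis using rk_insert_le[of e F] by linarith
qed

text \<open>Nothing lies strictly between \<open>X\<close> and \<open>Y\<close>, so \<open>X\<close>
  and any one element of \<open>Z\<close> outside \<open>X\<close> already span \<open>Y\<close>.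
  This is how two images under an adjoint map are shown to span a third.\<close>

lemma cover_subset_flat:
  assumes "X \<in> flats M" "Y \<in> flats M" "X \<subseteq> Y" "rk M Y \<le> Suc (rk M X)"
    and "Z \<subseteq> Y" "\<not> Z \<subseteq> X" and "W \<in> flats M" "X \<subseteq> W" "Z \<subseteq> W"
  shows "Y \<subseteq> W"
proof -
  obtain z where z: "z \<in> Z" "z \<notin> X" using assms(6) by blast
  then have sub: "insert z X \<subseteq> ground M" and "z \<in> ground M - X"
    using assms(3,5) flat_subset_ground[OF assms(2)] by auto
  then have "rk M Y \<le> rk M (cl M (insert z X))"
    using rk_insert_flat[OF assms(1)] rk_cl[OF sub] assms(4) by simp
  moreover have "cl M (insert z X) \<subseteq> Y"
    using assms(3,5) z(1) by (intro cl_subset_flat[OF assms(2)]) auto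
  ultimately have "cl M (insert z X) = Y"
    using flat_eq_if_rk_le[OF cl_flat[OF sub] flat_subset_ground[OF assms(2)]] by blast
  moreover have "cl M (insert z X) \<subseteq> W"
    using assms(8,9) z(1) by (intro cl_subset_flat[OF assms(7)]) auto
  ultimately show ?thesis by simp
qed

section \<open>Flats of rank one less inside a given flat\<close>

lemma indep_notin_cl:
  assumes "B \<in> indeps M" "b \<in> B"
  shows "b \<notin> cl M (B - {b})"
proof
  assume "b \<in> cl M (B - {b})"
  then have "rk M B = rk M (B - {b})" using assms(2) by (simp add: cl_def insert_absorb)
  moreover have "B - {b} \<in> indeps M" using indep_mono[OF assms(1)] by blast
  ultimately show False
    using rk_indep assms indep_finite[OF assms(1)] by (metis card_Diff1_less nat_neq_iff)
qed

lemma rk_cl_indep_remove: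
  assumes "B \<in> indeps M" "b \<in> B"
  shows "Suc (rk M (cl M (B - {b}))) = card B"
proof -
  have "B - {b} \<in> indeps M" using indep_mono[OF assms(1)] by blast
  then have "rk M (cl M (B - {b})) = card (B - {b})"
    using rk_cl rk_indep indeps_subset by simp
  then show ?thesis using card.remove[OF indep_finite[OF assms(1)] assms(2)] by simp
qed

text \<open>Take a basis of \<open>F\<close>, drop one element and close up.\<close>

lemma flat_coatom:
  assumes "F \<in> flats M" "rk M F \<noteq> 0"
  obtains A where "A \<in> flats M" "A \<subset> F" "Suc (rk M A) = rk M F"
proof -
  obtain B where B: "B \<in> indeps M" "B \<subseteq> F" "card B = rk M F" using rk_attained by blast
  then obtain b where b: "b \<in> B" using assms(2) by fastforce
  let ?A = "cl M (B - {b})"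
  have "?A \<in> flats M" using indeps_subset[OF B(1)] by (intro cl_flat) auto
  moreover have "?A \<subseteq> F" using B(2) by (intro cl_subset_flat[OF assms(1)]) auto
  moreover have "Suc (rk M ?A) = rk M F" using rk_cl_indep_remove[OF B(1) b] B(3) by simp
  ultimately show thesis using that by (metis n_not_Suc_n psubsetI)
qed

text \<open>Dropping different elements \<open>a\<close> and \<open>b\<close> of one basis gives
  different flats: \<open>a\<close> survives the removal of \<open>b\<close>, but is not in the span
  of the remaining elements once it is itself removed.\<close>

lemma flat_two_coatoms:
  assumes "F \<in> flats M" "2 \<le> rk M F"
  obtains A B where "A \<in> flats M" "A \<subset> F" "Suc (rk M A) = rk M F"
    "B \<in> flats M" "B \<subset> F" "Suc (rk M B) = rk M F" "A \<noteq> B"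
proof -
  obtain I where I: "I \<in> indeps M" "I \<subseteq> F" "card I = rk M F" using rk_attained by blast
  have "\<exists>a \<in> I. \<exists>b \<in> I. a \<noteq> b"
    using assms(2) I(3) card_le_Suc0_iff_eq[OF indep_finite[OF I(1)]] by fastforce
  then obtain a b where ab: "a \<in> I" "b \<in> I" "a \<noteq> b" by blast
  have coatom: "cl M (I - {x}) \<in> flats M \<and> cl M (I - {x}) \<subset> F
      \<and> Suc (rk M (cl M (I - {x}))) = rk M F" if "x \<in> I" for x
  proof -
    have "cl M (I - {x}) \<in> flats M" using indeps_subset[OF I(1)] by (intro cl_flat) auto
    moreover have "cl M (I - {x}) \<subseteq> F" using I(2) by (intro cl_subset_flat[OF assms(1)]) auto
    ultimately show ?thesis
      using rk_cl_indep_remove[OF I(1) that] I(3) by (metis n_not_Suc_n psubsetI)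
  qed
  have "a \<in> cl M (I - {b})" using subset_cl[of "I - {b}"] indeps_subset[OF I(1)] ab by auto
  then have "cl M (I - {a}) \<noteq> cl M (I - {b})" using indep_notin_cl[OF I(1) ab(1)] by blast
  then show thesis using that coatom ab by blast
qed

subsection \<open>Duality, restriction and contraction\<close>

lemma bases_iff: "B \<in> bases M \<longleftrightarrow> B \<in> indeps M \<and> card B = rk M (ground M)"
proof
  assume B: "B \<in> bases M"
  then have "B \<in> indeps M" by (simp add: bases_def)
  then obtain B' where "B' \<in> indeps M" "B \<subseteq> B'" "card B' = rk M (ground M)"
    using indep_extend indeps_subset by metis
  then show "B \<in> indeps M \<and> card B = rk M (ground M)" using B by (auto simp: bases_def)
next
  assume B: "B \<in> indeps M \<and> card B = rk M (ground M)"
  have "I = B" if "I \<in> indeps M" "B \<subseteq> I" for I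
    using card_seteq[OF indep_finite[OF that(1)] that(2)]
      card_le_rk[OF that(1) indeps_subset[OF that(1)]] B by simp
  then show "B \<in> bases M" using B by (simp add: bases_def)
qed

text \<open>Coindependent sets are the complements of spanning sets; in this form the dual is
  accessible through ranks in \<open>M\<close>.\<close>

lemma indep_dual_iff:
  "I \<in> indeps (dual M) \<longleftrightarrow> I \<subseteq> ground M \<and> rk M (ground M - I) = rk M (ground M)"
proof
  assume "I \<in> indeps (dual M)"
  then obtain B where B: "B \<in> indeps M" "card B = rk M (ground M)" "I \<subseteq> ground M - B"
    by (auto simp: dual_def bases_iff)
  then have "rk M (ground M) \<le> rk M (ground M - I)"
    using card_le_rk[OF B(1), of "ground M - I"] indeps_subset[OF B(1)] by auto
  then show "I \<subseteq> ground M \<and> rk M (ground M - I) = rk M (ground M)"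
    using rk_mono[of "ground M - I" "ground M"] B(3) by auto
next
  assume I: "I \<subseteq> ground M \<and> rk M (ground M - I) = rk M (ground M)"
  obtain B where B: "B \<in> indeps M" "B \<subseteq> ground M - I" "card B = rk M (ground M - I)"
    using rk_attained by blast
  then have "B \<in> bases M" "I \<subseteq> ground M - B" using I by (auto simp: bases_iff)
  then show "I \<in> indeps (dual M)" by (auto simp: dual_def)
qed

lemma ground_dual: "ground (dual M) = ground M"
  by (simp add: dual_def)

lemma matroid_dual: "matroid (dual M)"
proof
  show "finite (ground (dual M))" by (simp add: ground_dual finite_ground)
  show "{} \<in> indeps (dual M)" by (simp add: indep_dual_iff)
  show "I \<subseteq> ground (dual M)" if "I \<in> indeps (dual M)" for I
    using that by (simp add: indep_dual_iff ground_dual)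
  show "J \<in> indeps (dual M)" if "I \<in> indeps (dual M)" "J \<subseteq> I" for I J
    using that by (auto simp: dual_def)
next
  fix I J assume I: "I \<in> indeps (dual M)" and J: "J \<in> indeps (dual M)" and lt: "card I < card J"
  let ?r = "rk M (ground M)"
  have sub: "I \<subseteq> ground M" "J \<subseteq> ground M" using I J by (auto simp: indep_dual_iff)
  then have fin: "finite I" "finite J" using finite_ground finite_subset by auto
  obtain B where B: "B \<in> indeps M" "B \<subseteq> ground M - J" "card B = ?r"
    using rk_attained[of "ground M - J"] J by (auto simp: indep_dual_iff)
  have "B - I \<in> indeps M" using indep_mono[OF B(1)] by blast
  \<comment> \<open>The complement of \<open>I\<close> is spanning, so \<open>B - I\<close> grows to
    a basis of \<open>M\<close> that still avoids \<open>I\<close>. Any element of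
    \<open>J - I\<close> missed by \<open>D\<close> can then be added to \<open>I\<close>.\<close>
  then obtain D where D: "D \<in> indeps M" "B - I \<subseteq> D" "D \<subseteq> ground M - I" "card D = ?r"
    using indep_extend[of "B - I" "ground M - I"] B(2) I by (auto simp: indep_dual_iff)
  \<comment> \<open>Otherwise \<open>D\<close> contains the disjoint sets \<open>B - I\<close> and
    \<open>J - I\<close>. Since \<open>B\<close> avoids \<open>J\<close>, at most
    \<open>card (I - J)\<close> elements of \<open>B\<close> lie in \<open>I\<close>, and
    \<open>card (I - J) < card (J - I)\<close>, so \<open>D\<close> would be larger than
    \<open>B\<close>.\<close>
  have "\<not> J - I \<subseteq> D"
  proof
    assume "J - I \<subseteq> D"
    then have "card ((B - I) \<union> (J - I)) \<le> card D"
      using D(2) indep_finite[OF D(1)] by (intro card_mono) auto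
    moreover have "card ((B - I) \<union> (J - I)) = card (B - I) + card (J - I)"
      using B(2) fin indep_finite[OF B(1)] by (intro card_Un_disjoint) auto
    moreover have "card B = card (B \<inter> I) + card (B - I)"
      using card_Int_Diff[OF indep_finite[OF B(1)]] .
    moreover have "card (B \<inter> I) \<le> card (I - J)"
      using B(2) fin by (intro card_mono) auto
    moreover have "card I = card (I \<inter> J) + card (I - J)" "card J = card (J \<inter> I) + card (J - I)"
      using fin by (auto intro: card_Int_Diff)
    ultimately show False using lt B(3) D(4) by (simp add: Int_commute)
  qed
  then obtain e where e: "e \<in> J - I" "e \<notin> D" by blast
  have "D \<in> bases M" using D by (simp add: bases_iff)
  then have "insert e I \<in> indeps (dual M)" using D(3) e sub by (auto simp: dual_def)
  then show "\<exists>e \<in> J - I. insert e I \<in> indeps (dual M)" using e(1) by blast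
qed

text \<open>The corank formula, kept additive to avoid truncated subtraction. One inequality adds
  \<open>X - I\<close> to the complement of \<open>X\<close> for a largest coindependent
  \<open>I\<close> in \<open>X\<close>; the other extends a basis of the complement of
  \<open>X\<close> to a basis \<open>B\<close> of \<open>M\<close> and uses the coindependent set
  \<open>X - B\<close>.\<close>

lemma rk_dual:
  assumes "X \<subseteq> ground M"
  shows "rk (dual M) X + rk M (ground M) = card X + rk M (ground M - X)"
proof -
  interpret D: matroid "dual M" by (rule matroid_dual)
  let ?r = "rk M (ground M)"
  have finX: "finite X" using assms finite_ground finite_subset by blast
  obtain I where I: "I \<in> indeps (dual M)" "I \<subseteq> X" "card I = rk (dual M) X"
    using D.rk_attained by blast
  have "ground M - I = (ground M - X) \<union> (X - I)" using assms I(2) by blast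
  then have "?r \<le> rk M (ground M - X) + card (X - I)"
    using rk_union_le[of "X - I" "ground M - X"] I(1) finX by (simp add: indep_dual_iff)
  moreover have "card X = card I + card (X - I)"
    using card_Int_Diff[OF finX, of I] I(2) by (simp add: Int_absorb1)
  ultimately have le: "rk (dual M) X + ?r \<le> card X + rk M (ground M - X)" using I(3) by simp
  obtain A where A: "A \<in> indeps M" "A \<subseteq> ground M - X" "card A = rk M (ground M - X)"
    using rk_attained by blast
  then obtain B where B: "B \<in> indeps M" "A \<subseteq> B" "B \<subseteq> ground M" "card B = ?r"
    using indep_extend[of A "ground M"] by blast
  have "B \<in> bases M" using B by (simp add: bases_iff)
  then have "X - B \<in> indeps (dual M)" using assms by (auto simp: dual_def)
  then have "card (X - B) \<le> rk (dual M) X" using D.card_le_rk by blast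
  moreover have "card B = card (B \<inter> X) + card (B - X)"
    using card_Int_Diff[OF indep_finite[OF B(1)]] .
  moreover have "card A \<le> card (B - X)"
    using A(2) B(2) indep_finite[OF B(1)] by (intro card_mono) auto
  moreover have "card X = card (X \<inter> B) + card (X - B)" using card_Int_Diff[OF finX] .
  ultimately show ?thesis using le A(3) B(4) by (simp add: Int_commute)
qed

section \<open>Restriction to a subset, and to a flat\<close>

lemma matroid_restriction:
  assumes "X \<subseteq> ground M"
  shows "matroid (restriction M X)"
proof
  show "finite (ground (restriction M X))"
    using assms finite_ground finite_subset by (auto simp: restriction_def)
  show "{} \<in> indeps (restriction M X)" by (simp add: restriction_def empty_indep)
  show "I \<subseteq> ground (restriction M X)" if "I \<in> indeps (restriction M X)" for I
    using that by (simp add: restriction_def)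
  show "J \<in> indeps (restriction M X)" if "I \<in> indeps (restriction M X)" "J \<subseteq> I" for I J
    using that by (auto simp: restriction_def intro: indep_mono)
next
  fix I J
  assume "I \<in> indeps (restriction M X)" "J \<in> indeps (restriction M X)" "card I < card J"
  then show "\<exists>e \<in> J - I. insert e I \<in> indeps (restriction M X)"
    using augment[of I J] by (auto simp: restriction_def)
qed

lemma ground_restriction: "ground (restriction M X) = X"
  by (simp add: restriction_def)

lemma rk_restriction: "Y \<subseteq> X \<Longrightarrow> rk (restriction M X) Y = rk M Y"
  unfolding rk_def restriction_def by (rule arg_cong[of _ _ "\<lambda>S. Max (card ` S)"]) auto

text \<open>Since \<open>X\<close> is a flat, the closure in \<open>M\<close> of a subset of
  \<open>X\<close> stays inside \<open>X\<close>, so both closure operators agree there.\<close>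

lemma flats_restriction_flat:
  assumes "X \<in> flats M"
  shows "flats (restriction M X) = {F \<in> flats M. F \<subseteq> X}"
proof -
  have "cl (restriction M X) F = cl M F" if "F \<subseteq> X" for F
  proof -
    have "cl (restriction M X) F = cl M F \<inter> X"
      using that flat_subset_ground[OF assms]
      by (auto simp: cl_def ground_restriction rk_restriction)
    then show ?thesis using cl_subset_flat[OF assms that] by blast
  qed
  then show ?thesis using flat_subset_ground[OF assms] by (auto simp: flats_def ground_restriction)
qed

lemma points_restriction_flat:
  assumes "X \<in> flats M"
  shows "points (restriction M X) = {P \<in> points M. P \<subseteq> X}"
  using flats_restriction_flat[OF assms] by (auto simp: points_def rk_restriction)

section \<open>Contraction, computed through the dual\<close>

lemma ground_contraction: "ground (contraction M C) = ground M - C"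
  by (simp add: contraction_def deletion_def restriction_def dual_def)

lemma matroid_deletion_dual: "matroid (deletion (dual M) C)"
  unfolding deletion_def by (intro matroid.matroid_restriction matroid_dual) auto

lemma matroid_contraction: "matroid (contraction M C)"
  unfolding contraction_def by (rule matroid.matroid_dual[OF matroid_deletion_dual])

text \<open>The corank formula is applied once to the deleted dual and twice to the dual of
  \<open>M\<close>; all cardinalities then cancel.\<close>

lemma rk_contraction:
  assumes "C \<subseteq> ground M" "X \<subseteq> ground M - C"
  shows "rk (contraction M C) X + rk M C = rk M (X \<union> C)"
proof -
  let ?N = "deletion (dual M) C"
  interpret D: matroid "dual M" by (rule matroid_dual)
  have gN: "ground ?N = ground M - C"
    by (simp add: deletion_def D.ground_restriction ground_dual)
  have rN: "rk ?N Y = rk (dual M) Y" if "Y \<subseteq> ground M - C" for Y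
    unfolding deletion_def using that by (intro D.rk_restriction) (simp add: ground_dual)
  have "rk (contraction M C) X + rk (dual M) (ground M - C)
      = card X + rk (dual M) (ground M - C - X)"
    using matroid.rk_dual[OF matroid_deletion_dual, of X C] assms(2)
    by (simp add: contraction_def gN rN)
  moreover have "rk (dual M) (ground M - C) + rk M (ground M) = card (ground M - C) + rk M C"
    using rk_dual[of "ground M - C"] assms(1) by (simp add: double_diff)
  moreover have "ground M - (ground M - C - X) = X \<union> C" using assms by blast
  then have "rk (dual M) (ground M - C - X) + rk M (ground M)
      = card (ground M - C - X) + rk M (X \<union> C)"
    using rk_dual[of "ground M - C - X"] by auto
  moreover have "card (ground M - C) = card X + card (ground M - C - X)"
    using card_Int_Diff[of "ground M - C" X] finite_ground assms(2) by (simp add: Int_absorb1)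
  ultimately show ?thesis by linarith
qed

text \<open>By the rank formula, closing \<open>F\<close> in the contraction amounts to closing
  \<open>F \<union> C\<close> in \<open>M\<close> and removing \<open>C\<close>.\<close>

lemma flats_contraction_iff:
  assumes "C \<subseteq> ground M" "F \<subseteq> ground M - C"
  shows "F \<in> flats (contraction M C) \<longleftrightarrow> F \<union> C \<in> flats M"
proof -
  have "cl (contraction M C) F = cl M (F \<union> C) - C"
  proof -
    have "rk (contraction M C) (insert e F) = rk (contraction M C) F
        \<longleftrightarrow> rk M (insert e (F \<union> C)) = rk M (F \<union> C)" if "e \<in> ground M - C" for e
      using rk_contraction[OF assms] rk_contraction[OF assms(1), of "insert e F"] assms(2) that
      by auto
    then show ?thesis unfolding cl_def ground_contraction by blast
  qed
  moreover have "C \<subseteq> cl M (F \<union> C)" using subset_cl[of "F \<union> C"] assms by blast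
  ultimately show ?thesis
    using assms by (auto simp: flats_def ground_contraction)
qed

lemma hyperplanes_contraction_iff:
  assumes "C \<subseteq> ground M" "F \<subseteq> ground M - C"
  shows "F \<in> hyperplanes (contraction M C) \<longleftrightarrow> F \<union> C \<in> hyperplanes M"
proof -
  have "rk (contraction M C) (ground M - C) + rk M C = rk M (ground M)"
    using rk_contraction[OF assms(1), of "ground M - C"] assms(1) by (simp add: Un_absorb2)
  then show ?thesis
    using rk_contraction[OF assms] flats_contraction_iff[OF assms]
    by (auto simp: hyperplanes_def ground_contraction)
qed

end

lemma (in simple_matroid) simple_matroid_restriction:
  assumes "X \<subseteq> ground M"
  shows "simple_matroid (restriction M X)"
proof -
  have "K \<in> circuits M" if "K \<in> circuits (restriction M X)" for K
    using that assms by (auto simp: circuits_def restriction_def)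
  then show ?thesis
    using matroid_restriction[OF assms] no_loop no_parallel
    by (auto simp: simple_matroid_def simple_matroid_axioms_def)
qed

subsection \<open>Adjoint maps\<close>

context adjoint_map
begin

lemma antimono_strict:
  "\<lbrakk>F \<in> flats M; G \<in> flats M; F \<subset> G\<rbrakk> \<Longrightarrow> \<phi> G \<subset> \<phi> F"
  using antimono_flats[of F G] inj_onD[OF inj_flats, of F G] by auto

lemma rk_strict:
  "\<lbrakk>F \<in> flats M; G \<in> flats M; F \<subset> G\<rbrakk> \<Longrightarrow> rk M' (\<phi> G) < rk M' (\<phi> F)"
  using antimono_strict maps_flats M'.flat_rk_strict M'.flat_subset_ground by meson

text \<open>Descend from \<open>F\<close> one rank at a time: each step enlarges the image strictly,
  hence raises its rank, which is bounded by the common rank of the two matroids.\<close>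

lemma rk_add_le: "F \<in> flats M \<Longrightarrow> rk M' (\<phi> F) + rk M F \<le> rk M (ground M)"
proof (induction "rk M F" arbitrary: F)
  case 0
  then show ?case
    using M'.rk_mono[OF M'.flat_subset_ground[OF maps_flats]] same_rank by (metis add.right_neutral)
next
  case (Suc n)
  then obtain A where A: "A \<in> flats M" "A \<subset> F" "Suc (rk M A) = rk M F"
    using M.flat_coatom by (metis nat.distinct(1))
  have "rk M' (\<phi> A) + rk M A \<le> rk M (ground M)"
    using Suc.hyps(1)[of A] Suc.hyps(2) A by simp
  then show ?case using rk_strict[OF A(1) Suc.prems A(2)] A(3) by linarith
qed

text \<open>The opposite direction: ascend from \<open>F\<close> to the ground set one rank at a
  time, the image losing rank at each step.\<close>

lemma le_rk_add: "F \<in> flats M \<Longrightarrow> rk M (ground M) \<le> rk M' (\<phi> F) + rk M F"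
proof (induction "rk M (ground M) - rk M F" arbitrary: F rule: less_induct)
  case less
  show ?case
  proof (cases "F = ground M")
    case False
    then obtain e where e: "e \<in> ground M - F" using M.flat_subset_ground[OF less.prems] by blast
    let ?G = "cl M (insert e F)"
    have sub: "insert e F \<subseteq> ground M" using e M.flat_subset_ground[OF less.prems] by blast
    have G: "?G \<in> flats M" "F \<subset> ?G" using M.cl_flat[OF sub] M.subset_cl[OF sub] e by auto
    have rG: "rk M ?G = Suc (rk M F)" using M.rk_cl[OF sub] M.rk_insert_flat[OF less.prems e] by simp
    moreover have "rk M ?G \<le> rk M (ground M)" by (intro M.rk_mono M.cl_subset_ground)
    ultimately have "rk M (ground M) \<le> rk M' (\<phi> ?G) + rk M ?G"
      using less.hyps[OF _ G(1)] by linarith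
    then show ?thesis using rk_strict[OF less.prems G] rG by linarith
  qed simp
qed

lemma rk_add: "F \<in> flats M \<Longrightarrow> rk M' (\<phi> F) + rk M F = rk M (ground M)"
  by (rule antisym[OF rk_add_le le_rk_add])

text \<open>A converse to antimonotonicity, needed for surjectivity onto the points of the
  restriction. The outer induction goes down from flats \<open>F\<close> of large rank; the inner
  one, for \<open>below\<close>, goes up the ranks of flats inside \<open>H\<close>.\<close>

lemma hyperplane_image_subset:
  assumes "H \<in> hyperplanes M" and "F \<in> flats M" and "\<phi> H \<subseteq> \<phi> F"
  shows "F \<subseteq> H"
  using assms(2,3)
proof (induction "rk M (ground M) - rk M F" arbitrary: F rule: less_induct)
  case less
  note F = less.prems(1) and HF = less.prems(2) and larger = less.hyps
  have H: "H \<in> flats M" using assms(1) by (simp add: hyperplanes_def)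
  show ?case
  proof (rule ccontr)
    assume nle: "\<not> F \<subseteq> H"
    have below: "\<phi> F \<subseteq> \<phi> L" if "L \<in> flats M" "L \<subseteq> H" for L
      using that
    proof (induction "rk M L" arbitrary: L rule: less_induct)
      case (less L)
      note L = less.prems(1)
      \<comment> \<open>In the middle case \<open>L\<close> has rank exactly 1, because its element
        \<open>e\<close> outside the flat \<open>F\<close> is not a loop.\<close>
      consider "L \<subseteq> F" | e where "rk M L \<le> 1" "e \<in> L" "e \<notin> F" | "2 \<le> rk M L" by fastforce
      then show ?case
      proof cases
        case 1
        then show ?thesis using antimono_flats[OF L F] by simp
      next
        case 2
        let ?G = "cl M (insert e F)"
        have e: "e \<in> ground M - F" using 2 M.flat_subset_ground[OF L] by blast
        then have sub: "insert e F \<subseteq> ground M" using M.flat_subset_ground[OF F] by blast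
        have G: "?G \<in> flats M" "F \<subset> ?G" using M.cl_flat[OF sub] M.subset_cl[OF sub] 2 by auto
        have rG: "rk M ?G = Suc (rk M F)" using M.rk_cl[OF sub] M.rk_insert_flat[OF F e] by simp
        have "rk M ?G \<le> rk M (ground M)" by (intro M.rk_mono M.cl_subset_ground)
        then have "rk M (ground M) - rk M ?G < rk M (ground M) - rk M F" using rG by linarith
        \<comment> \<open>\<open>?G\<close> contains \<open>F\<close>, so it is not inside
          \<open>H\<close>; as its rank exceeds that of \<open>F\<close>, the outer hypothesis
          applies. Thus \<open>\<phi> H\<close> contributes an element of \<open>\<phi> F\<close>
          outside \<open>\<phi> ?G\<close>.\<close>
        then have "\<not> \<phi> H \<subseteq> \<phi> ?G" using larger[OF _ G(1)] nle G(2) by blast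
        moreover have "L \<subseteq> ?G"
        proof -
          have "rk M {e} \<noteq> rk M {}"
            using M.rk_insert_eq_mono[of "{}" F e] M.rk_insert_flat[OF F e] by auto
          then have "rk M L \<le> rk M (cl M {e})" using 2(1) M.rk_mono[of "{}" "{e}"] M.rk_cl e by simp
          then have "cl M {e} = L"
            using M.flat_eq_if_rk_le[OF M.cl_flat M.flat_subset_ground[OF L]]
              M.cl_subset_flat[OF L] 2(2) e by simp
          then show ?thesis using M.cl_mono[of "{e}" "insert e F"] by simp
        qed
        then have "\<phi> ?G \<subseteq> \<phi> L" by (rule antimono_flats[OF L G(1)])
        moreover have "\<phi> ?G \<subseteq> \<phi> F" using antimono_flats[OF F G(1)] G(2) by simp
        moreover have "\<phi> H \<subseteq> \<phi> L" by (rule antimono_flats[OF L H less.prems(2)])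
        moreover have "rk M' (\<phi> F) \<le> Suc (rk M' (\<phi> ?G))"
          using rk_add[OF F] rk_add[OF G(1)] rG by linarith
        ultimately show ?thesis
          using M'.cover_subset_flat[of "\<phi> ?G" "\<phi> F" "\<phi> H" "\<phi> L"] maps_flats F G(1) L HF by simp
      next
        case 3
        then obtain A B where A: "A \<in> flats M" "A \<subset> L" "Suc (rk M A) = rk M L"
          and B: "B \<in> flats M" "B \<subset> L" "Suc (rk M B) = rk M L" and "A \<noteq> B"
          using M.flat_two_coatoms[OF L] by metis
        \<comment> \<open>Inner hypothesis for \<open>A\<close> and \<open>B\<close>, which lie in
          \<open>H\<close> because \<open>L\<close> does.\<close>
        have up: "\<phi> F \<subseteq> \<phi> A" "\<phi> F \<subseteq> \<phi> B" using less.hyps less.prems(2) A B by auto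
        have LA: "\<phi> L \<subseteq> \<phi> A" "\<phi> L \<subseteq> \<phi> B"
          using antimono_flats[OF _ L] A B by (auto simp: psubset_eq)
        have rA: "rk M' (\<phi> A) = Suc (rk M' (\<phi> L))" "rk M' (\<phi> B) = rk M' (\<phi> A)"
          using rk_add[OF A(1)] rk_add[OF B(1)] rk_add[OF L] A(3) B(3) by linarith+
        show ?thesis
        proof (rule ccontr)
          assume "\<not> \<phi> F \<subseteq> \<phi> L"
          \<comment> \<open>\<open>\<phi> A\<close> covers \<open>\<phi> L\<close>, so it is spanned
            by \<open>\<phi> L\<close> and \<open>\<phi> F\<close>, both of which lie in
            \<open>\<phi> B\<close>. Equal ranks then force equality, against injectivity.\<close>
          then have "\<phi> A \<subseteq> \<phi> B"
            using M'.cover_subset_flat[of "\<phi> L" "\<phi> A" "\<phi> F" "\<phi> B"] up LA rA maps_flats A(1) B(1) L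
            by simp
          then have "\<phi> A = \<phi> B"
            using M'.flat_eq_if_rk_le maps_flats[OF A(1)] M'.flat_subset_ground[OF maps_flats[OF B(1)]]
              rA(2) by simp
          then show False using inj_onD[OF inj_flats] A(1) B(1) \<open>A \<noteq> B\<close> by blast
        qed
      qed
    qed
    have "\<phi> F = \<phi> H" using below[OF H] HF by blast
    then show False using inj_onD[OF inj_flats] F H nle by blast
  qed
qed

end

theorem proposition3p1:
  fixes M :: "'a indep_system" and M' :: "'b indep_system"
    and \<phi> :: "'a set \<Rightarrow> 'b set" and C :: "'a set"
  assumes "matroid M" and "adjoint_map M M' \<phi>" and "C \<subseteq> ground M"
  shows "adjoint_map (contraction M C) (restriction M' (\<phi> (cl M C))) (\<lambda>F. \<phi> (F \<union> C))"
proof -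
  interpret adjoint_map M M' \<phi> by (rule assms(2))
  let ?N = "contraction M C" and ?X = "\<phi> (cl M C)" and ?\<psi> = "\<lambda>F. \<phi> (F \<union> C)"
  let ?N' = "restriction M' ?X"
  interpret N: matroid ?N by (rule M.matroid_contraction)
  have clC: "cl M C \<in> flats M" by (rule M.cl_flat[OF assms(3)])
  have X: "?X \<in> flats M'" by (rule maps_flats[OF clC])
  interpret N': simple_matroid ?N'
    by (rule M'.simple_matroid_restriction[OF M'.flat_subset_ground[OF X]])
  have sub: "F \<subseteq> ground M - C" if "F \<in> flats ?N" for F
    using N.flat_subset_ground[OF that] by (simp add: M.ground_contraction)
  have flat: "F \<union> C \<in> flats M" if "F \<in> flats ?N" for F
    using that M.flats_contraction_iff[OF assms(3) sub[OF that]] by simp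
  \<comment> \<open>A flat containing \<open>C\<close> contains \<open>cl M C\<close>, and
    \<open>\<phi>\<close> reverses this inclusion.\<close>
  have below: "\<phi> F \<subseteq> ?X" if "F \<in> flats M" "C \<subseteq> F" for F
    using antimono_flats[OF clC that(1) M.cl_subset_flat[OF that]] .
  have inj: "inj_on ?\<psi> (flats ?N)"
  proof (rule inj_onI)
    fix F G assume F: "F \<in> flats ?N" and G: "G \<in> flats ?N" and "\<phi> (F \<union> C) = \<phi> (G \<union> C)"
    then have "F \<union> C = G \<union> C" using inj_onD[OF inj_flats] flat by blast
    then show "F = G" using sub[OF F] sub[OF G] by blast
  qed
  have hyp: "F \<in> flats ?N \<and> F \<union> C \<in> hyperplanes M" if "F \<in> hyperplanes ?N" for F
  proof -
    have "F \<in> flats ?N" using that by (simp add: hyperplanes_def)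
    then show ?thesis using that M.hyperplanes_contraction_iff[OF assms(3) sub] by blast
  qed
  have "?\<psi> ` hyperplanes ?N = points ?N'"
  proof (intro subset_antisym subsetI)
    fix P assume "P \<in> ?\<psi> ` hyperplanes ?N"
    then obtain F where F: "F \<in> hyperplanes ?N" "P = \<phi> (F \<union> C)" by blast
    then show "P \<in> points ?N'"
      using hyp[OF F(1)] flat below bij_betwE[OF bij_hyperplanes_points]
      by (simp add: M'.points_restriction_flat[OF X])
  next
    fix P assume "P \<in> points ?N'"
    then have P: "P \<in> points M'" "P \<subseteq> ?X" by (simp_all add: M'.points_restriction_flat[OF X])
    then obtain H where H: "H \<in> hyperplanes M" "P = \<phi> H"
      using bij_betw_imp_surj_on[OF bij_hyperplanes_points] by blast
    \<comment> \<open>The crucial use of the converse to antimonotonicity: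
      \<open>\<phi> H \<subseteq> \<phi> (cl M C)\<close> puts \<open>cl M C\<close> inside
      \<open>H\<close>, so \<open>H - C\<close> is a hyperplane of the contraction.\<close>
    have "C \<subseteq> H"
      using hyperplane_image_subset[OF H(1) clC] P(2) H(2) M.subset_cl[OF assms(3)] by blast
    moreover have "H \<subseteq> ground M"
      using H(1) M.flat_subset_ground by (simp add: hyperplanes_def)
    ultimately have "H - C \<subseteq> ground M - C" and HC: "(H - C) \<union> C = H" by auto
    then have "H - C \<in> hyperplanes ?N"
      using H(1) M.hyperplanes_contraction_iff[OF assms(3), of "H - C"] by simp
    moreover have "P = ?\<psi> (H - C)" using H(2) HC by simp
    ultimately show "P \<in> ?\<psi> ` hyperplanes ?N" by blast
  qed
  moreover have "inj_on ?\<psi> (hyperplanes ?N)" using inj_on_subset[OF inj] hyp by blast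
  ultimately have bij: "bij_betw ?\<psi> (hyperplanes ?N) (points ?N')" by (simp add: bij_betw_def)
  \<comment> \<open>Both \<open>rk ?N (ground ?N)\<close> and the rank of
    \<open>\<phi> (cl M C)\<close> complement \<open>rk M C\<close> to the rank of \<open>M\<close>,
    so they agree.\<close>
  have "rk ?N (ground M - C) + rk M C = rk M (ground M)"
    using M.rk_contraction[OF assms(3), of "ground M - C"] assms(3) by (simp add: Un_absorb2)
  then have "rk ?N' (ground ?N') = rk ?N (ground ?N)"
    using rk_add[OF clC] M.rk_cl[OF assms(3)]
    by (simp add: M'.ground_restriction M'.rk_restriction M.ground_contraction)
  moreover have "\<phi> (F \<union> C) \<in> flats ?N'" if "F \<in> flats ?N" for F
    using maps_flats[OF flat[OF that]] below[OF flat[OF that]]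
    by (simp add: M'.flats_restriction_flat[OF X])
  moreover have "\<phi> (G \<union> C) \<subseteq> \<phi> (F \<union> C)" if "F \<in> flats ?N" "G \<in> flats ?N" "F \<subseteq> G" for F G
    using antimono_flats[OF flat[OF that(1)] flat[OF that(2)]] that(3) by blast
  ultimately show ?thesis by unfold_locales (use inj bij in blast)+
qed

end
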